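(* Let $A,B$ be symmetric operators in a real or complex Hilbert space $H$. Assume that $A$ is essentially selfadjoint and that a) $B$ is $A$-bounded; b) there is some $b>0$ such that $\|Bx\|^2\leq\|Ax\|^2+\|(A+B)x\|^2+b^2\|x\|^2$ for all $x\in\operatorname{dom}A$. Then $A+B$ is essentially selfadjoint.
   Context: Operators are (possibly unbounded) linear maps defined on a linear subspace of $H$; $\operatorname{dom}(A+B)=\operatorname{dom}A\cap\operatorname{dom}B$. An operator $A$ is symmetric if $(Ax\,|\,y)=(x\,|\,Ay)$ for all $x,y\in\operatorname{dom}A$, and essentially selfadjoint if it is closable and its closure is a (densely defined) selfadjoint operator. $B$ is called $A$-bounded if $\operatorname{dom}A\subseteq\operatorname{dom}B$ and there exist $\alpha,\beta\geq0$ with $\|Bx\|^2\leq\alpha\|Ax\|^2+\beta\|x\|^2$ for all $x\in\operatorname{dom}A$. *)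

theory Defs
  imports "HOL-Analysis.Analysis"
begin

text \<open>
  The two axioms already determine the scalar field: \<open>conj z = |z|\<^sup>2 / z\<close> for \<open>z \<noteq> 0\<close>, and
  lemma \<open>real_or_complex_cases\<close> shows that a type of this class is a copy of the real or of the
  complex numbers.
\<close>
class real_or_complex = real_normed_field +
  fixes conj :: "'a \<Rightarrow> 'a"
  assumes conj_add: "conj (x + y) = conj x + conj y"
    and mult_conj_scaleR: "x * conj x = (norm x)\<^sup>2 *\<^sub>R 1"

lemma mult_conj: "x * conj x = of_real ((norm x)\<^sup>2)" for x :: "'a::real_or_complex"
  unfolding of_real_def by (rule mult_conj_scaleR)

instantiation real :: real_or_complex
begin
definition conj_real :: "real \<Rightarrow> real" where "conj_real x = x"
instance
  by standard (simp_all add: conj_real_def power2_eq_square)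
end

instantiation complex :: real_or_complex
begin
definition conj_complex :: "complex \<Rightarrow> complex" where "conj_complex = cnj"
instance
  by standard (simp_all add: conj_complex_def scaleR_conv_of_real complex_norm_square del: of_real_power)
end

lemma real_or_complex_cases:
  "(\<forall>z :: 'k::real_or_complex. z \<in> \<real>) \<or>
   (\<exists>i :: 'k. i * i = - 1 \<and> (\<forall>z. \<exists>a b. z = of_real a + of_real b * i))"
proof -
  have conj0: "conj (0::'k) = 0"
    using conj_add[of "0::'k" 0] by simp
  have conj1: "conj (1::'k) = 1"
    using mult_conj[of "1::'k"] by simp
  have conj_uminus: "conj (- z) = - conj z" for z :: 'k
    using conj_add[of z "- z"] conj0 by (simp add: eq_neg_iff_add_eq_0 add.commute)
  have conj_eq: "conj z = of_real ((norm z)\<^sup>2) / z" if "z \<noteq> 0" for z :: 'k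
    using mult_conj[of z] that by (simp add: field_simps)
  have conj_divide: "conj (z / w) = conj z / conj w" if "w \<noteq> 0" for z w :: 'k
  proof (cases "z = 0")
    case False
    then show ?thesis
      using that conj_eq[of z] conj_eq[of w] conj_eq[of "z / w"]
      by (simp add: norm_divide power_divide)
  qed (simp add: conj0)
  have re: "z + conj z \<in> \<real>" for z :: 'k
  proof -
    have "(1 + z) * (1 + conj z) = of_real ((norm (1 + z))\<^sup>2)"
      using mult_conj[of "1 + z"] by (simp add: conj_add conj1)
    then have "z + conj z = of_real ((norm (1 + z))\<^sup>2 - 1 - (norm z)\<^sup>2)"
      using mult_conj[of z] by (simp add: algebra_simps)
    then show ?thesis by (metis Reals_of_real)
  qed
  have conj_conj: "conj (conj z) = z" for z :: 'k
  proof (cases "z = 0")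
    case False
    obtain r where r: "z + conj z = of_real r" using re[of z] by (auto elim: Reals_cases)
    have r': "conj (of_real r :: 'k) = of_real r"
    proof (cases "r = 0")
      case False
      then show ?thesis
        using conj_eq[of "of_real r"] by (simp add: power2_eq_square)
    qed (simp add: conj0)
    have "conj z + conj (conj z) = of_real r"
      using r r' by (metis conj_add)
    then show ?thesis using r by (metis add.commute add_right_cancel)
  qed (simp add: conj0)
  have fixed: "z \<in> \<real>" if "conj z = z" for z :: 'k
  proof -
    have "z + z \<in> \<real>" using re[of z] that by simp
    then have "(z + z) / 2 \<in> \<real>" by (rule Reals_divide) simp
    then show ?thesis by simp
  qed
  show ?thesis
  proof (cases "\<forall>z :: 'k. conj z = z")
    case True
    then show ?thesis using fixed by blast
  next
    case False
    then obtain u :: 'k where u: "conj u \<noteq> u" by blast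
    define w where "w = u - conj u"
    have w0: "w \<noteq> 0" using u by (simp add: w_def)
    have conjw: "conj w = - w"
      using conj_add[of u "- conj u"] by (simp add: w_def conj_uminus conj_conj)
    define i :: 'k where "i = w / of_real (norm w)"
    have i0: "i \<noteq> 0" using w0 by (simp add: i_def)
    have ww: "w * w = - of_real ((norm w)\<^sup>2)"
      using mult_conj[of w] unfolding conjw by (metis minus_minus mult_minus_right)
    have "i * i = (w * w) / of_real ((norm w)\<^sup>2)"
      by (simp add: i_def power2_eq_square)
    also have "\<dots> = - 1" unfolding ww using w0 by simp
    finally have ii: "i * i = - 1" .
    have ninorm: "norm i = 1" using w0 by (simp add: i_def norm_divide)
    have conji: "conj i = - i"
      using mult_conj[of i] mult_left_cancel[OF i0, of "conj i" "- i"] ii ninorm by simp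
    have "\<exists>a b. z = of_real a + of_real b * i" for z :: 'k
    proof -
      have "(z + conj z) / 2 \<in> \<real>" using re[of z] by (rule Reals_divide) simp
      then obtain a where a: "(z + conj z) / 2 = of_real a" by (auto elim: Reals_cases)
      have c: "conj (z - conj z) = - (z - conj z)"
        using conj_add[of z "- conj z"] by (simp add: conj_uminus conj_conj)
      have "conj ((z - conj z) / i) = (z - conj z) / i"
        unfolding conj_divide[OF i0] c conji by (rule minus_divide_divide)
      then have "(z - conj z) / i \<in> \<real>" by (rule fixed)
      then have "(z - conj z) / i / 2 \<in> \<real>" by (rule Reals_divide) simp
      then obtain b where b: "(z - conj z) / i / 2 = of_real b" by (auto elim: Reals_cases)
      have "z = (z + conj z) / 2 + ((z - conj z) / i / 2) * i"
        using i0 by (simp add: field_simps)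
      then show ?thesis unfolding a b by blast
    qed
    then show ?thesis using ii by blast
  qed
qed

text \<open>
  The norm and its completeness come from the class \<^class>\<open>banach\<close>; \<open>ip_self\<close> says that the inner
  product \<open>ip\<close>, linear in its first argument, induces this norm, which makes it positive definite.
\<close>
locale hilbert_space = vector_space smul
  for smul :: "'k::real_or_complex \<Rightarrow> 'h::banach \<Rightarrow> 'h" +
  fixes ip :: "'h \<Rightarrow> 'h \<Rightarrow> 'k"
  assumes scale_of_real: "smul (of_real r) x = r *\<^sub>R x"
    and ip_add_left: "ip (x + y) z = ip x z + ip y z"
    and ip_scale_left: "ip (smul c x) y = c * ip x y"
    and ip_commute: "ip y x = conj (ip x y)"
    and ip_self: "ip x x = of_real ((norm x)\<^sup>2)"

lemma hilbert_space_real: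
  "hilbert_space (*\<^sub>R) ((\<bullet>) :: 'h::{real_inner, banach} \<Rightarrow> 'h \<Rightarrow> real)"
  by unfold_locales
    (simp_all add: conj_real_def inner_commute inner_add_left inner_add_right power2_norm_eq_inner
      scaleR_right_distrib scaleR_left_distrib)

lemma hilbert_space_complex: "hilbert_space (*) (\<lambda>x y :: complex. x * cnj y)"
  by unfold_locales
    (simp_all add: conj_complex_def algebra_simps scaleR_conv_of_real complex_norm_square del: of_real_power)

text \<open>
  An operator in \<open>'h\<close> is a partial function \<open>A :: 'h \<rightharpoonup> 'h\<close> with domain \<^term>\<open>dom A\<close>; since the
  value outside the domain is \<^term>\<open>None\<close>, equality of operators includes equality of domains.
\<close>
abbreviation app :: "('h \<rightharpoonup> 'h) \<Rightarrow> 'h \<Rightarrow> 'h"  (infixl "\<cdot>" 90)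
  where "A \<cdot> x \<equiv> the (A x)"

definition linear_operator :: "('k::field \<Rightarrow> 'h::ab_group_add \<Rightarrow> 'h) \<Rightarrow> ('h \<rightharpoonup> 'h) \<Rightarrow> bool"
  where "linear_operator smul A \<longleftrightarrow>
    module.subspace smul (dom A) \<and>
    (\<forall>x\<in>dom A. \<forall>y\<in>dom A. A \<cdot> (x + y) = A \<cdot> x + A \<cdot> y) \<and>
    (\<forall>c. \<forall>x\<in>dom A. A \<cdot> (smul c x) = smul c (A \<cdot> x))"

definition operator_plus :: "('h::plus \<rightharpoonup> 'h) \<Rightarrow> ('h \<rightharpoonup> 'h) \<Rightarrow> ('h \<rightharpoonup> 'h)"  (infixl "\<oplus>" 65)
  where "A \<oplus> B = (\<lambda>x. if x \<in> dom A \<inter> dom B then Some (A \<cdot> x + B \<cdot> x) else None)"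

definition symmetric :: "('h \<Rightarrow> 'h \<Rightarrow> 'k) \<Rightarrow> ('h \<rightharpoonup> 'h) \<Rightarrow> bool"
  where "symmetric ip A \<longleftrightarrow> (\<forall>x\<in>dom A. \<forall>y\<in>dom A. ip (A \<cdot> x) y = ip x (A \<cdot> y))"

definition closable :: "('h::topological_space \<rightharpoonup> 'h) \<Rightarrow> bool"
  where "closable A \<longleftrightarrow> single_valued (closure (Map.graph A))"

text \<open>The operator whose graph is the closure of the graph of \<open>A\<close>; meaningful for closable \<open>A\<close>.\<close>
definition operator_closure :: "('h::topological_space \<rightharpoonup> 'h) \<Rightarrow> ('h \<rightharpoonup> 'h)"
  where "operator_closure A = (\<lambda>x. if x \<in> Domain (closure (Map.graph A))
    then Some (THE y. (x, y) \<in> closure (Map.graph A)) else None)"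

definition densely_defined :: "('h::topological_space \<rightharpoonup> 'h) \<Rightarrow> bool"
  where "densely_defined A \<longleftrightarrow> closure (dom A) = UNIV"

text \<open>Meaningful for densely defined \<open>A\<close>, where the vector \<open>z\<close> below is unique.\<close>
definition adjoint_operator :: "('h \<Rightarrow> 'h \<Rightarrow> 'k) \<Rightarrow> ('h \<rightharpoonup> 'h) \<Rightarrow> ('h \<rightharpoonup> 'h)"
  where "adjoint_operator ip A = (\<lambda>y. if \<exists>z. \<forall>x\<in>dom A. ip (A \<cdot> x) y = ip x z
    then Some (THE z. \<forall>x\<in>dom A. ip (A \<cdot> x) y = ip x z) else None)"

definition selfadjoint :: "('h::topological_space \<Rightarrow> 'h \<Rightarrow> 'k) \<Rightarrow> ('h \<rightharpoonup> 'h) \<Rightarrow> bool"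
  where "selfadjoint ip A \<longleftrightarrow> densely_defined A \<and> adjoint_operator ip A = A"

definition essentially_selfadjoint :: "('h::topological_space \<Rightarrow> 'h \<Rightarrow> 'k) \<Rightarrow> ('h \<rightharpoonup> 'h) \<Rightarrow> bool"
  where "essentially_selfadjoint ip A \<longleftrightarrow> closable A \<and> selfadjoint ip (operator_closure A)"

definition relatively_bounded :: "('h::real_normed_vector \<rightharpoonup> 'h) \<Rightarrow> ('h \<rightharpoonup> 'h) \<Rightarrow> bool"
  where "relatively_bounded A B \<longleftrightarrow> dom A \<subseteq> dom B \<and>
    (\<exists>\<alpha>\<ge>0. \<exists>\<beta>\<ge>0. \<forall>x\<in>dom A. (norm (B \<cdot> x))\<^sup>2 \<le> \<alpha> * (norm (A \<cdot> x))\<^sup>2 + \<beta> * (norm x)\<^sup>2)"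

end

theory Submission
  imports Defs
begin

text \<open>
  Put \<open>T = A + B\<close>. Expanding \<open>\<parallel>Bx\<parallel>\<^sup>2 = \<parallel>Tx - Ax\<parallel>\<^sup>2\<close>, condition (b) reads
  \<open>Re \<langle>Ax, Tx\<rangle> \<ge> - (b\<^sup>2/2) \<parallel>x\<parallel>\<^sup>2\<close>, so \<open>Re \<langle>(T + \<i>b)z, (A + \<i>b)z\<rangle> \<ge> (b\<^sup>2/2) \<parallel>z\<parallel>\<^sup>2\<close> on \<open>dom A\<close>.
  Let \<open>w\<close> be orthogonal to the range of \<open>T + \<i>b\<close>. As \<open>A\<close> is essentially selfadjoint,
  \<open>w = lim (A + \<i>b)z\<^sub>n\<close> for some \<open>z\<^sub>n \<in> dom A\<close>, and \<open>(T + \<i>b)z\<^sub>n\<close> is bounded by (a). Hence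
  \<open>(b\<^sup>2/2) \<parallel>z\<^sub>n\<parallel>\<^sup>2 \<le> Re \<langle>(T + \<i>b)z\<^sub>n, (A + \<i>b)z\<^sub>n - w\<rangle>\<close> tends to \<open>0\<close>, and since \<open>A\<close> is symmetric
  with dense domain, \<open>w = 0\<close>. To treat both scalar fields at once, everything is done for the real
  inner product \<open>Re \<langle>x, y\<rangle>\<close>, with pairs \<open>(x, y)\<close> in the role of \<open>x + \<i>y\<close>.
\<close>

section \<open>Real Hilbert spaces\<close>

lemma subspace_closure:
  fixes S :: "'a::real_normed_vector set"
  assumes "subspace S"
  shows "subspace (closure S)"
proof (rule subspaceI)
  show "0 \<in> closure S"
    using subspace_0[OF assms] closure_subset by blast
next
  fix x y assume "x \<in> closure S" "y \<in> closure S"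
  then obtain f g where "\<And>n. f n \<in> S" "f \<longlonglongrightarrow> x" "\<And>n. g n \<in> S" "g \<longlonglongrightarrow> y"
    unfolding closure_sequential by metis
  then show "x + y \<in> closure S"
    unfolding closure_sequential
    by (intro exI[of _ "\<lambda>n. f n + g n"]) (auto intro: tendsto_add subspace_add[OF assms])
next
  fix c :: real and x assume "x \<in> closure S"
  then obtain f where "\<And>n. f n \<in> S" "f \<longlonglongrightarrow> x"
    unfolding closure_sequential by metis
  then show "c *\<^sub>R x \<in> closure S"
    unfolding closure_sequential
    by (intro exI[of _ "\<lambda>n. c *\<^sub>R f n"]) (auto intro: tendsto_scaleR subspace_scale[OF assms])
qed

text \<open>The inner product is a parameter because two are needed: the real part of
  \<open>ip\<close> on \<open>'h\<close>, and the sum form on pairs. Norm and completeness stay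
  those of the type class.\<close>

locale real_hilbert =
  fixes inn :: "'h::banach \<Rightarrow> 'h \<Rightarrow> real"
  assumes inn_add: "inn (x + y) z = inn x z + inn y z"
    and inn_scaleR: "inn (r *\<^sub>R x) y = r * inn x y"
    and inn_commute: "inn x y = inn y x"
    and inn_self: "inn x x = (norm x)\<^sup>2"
begin

lemma inn_add_right: "inn z (x + y) = inn z x + inn z y"
  using inn_add inn_commute by metis

lemma inn_scaleR_right: "inn y (r *\<^sub>R x) = r * inn y x"
  using inn_scaleR inn_commute by metis

lemma Cauchy_Schwarz: "\<bar>inn x y\<bar> \<le> norm x * norm y"
proof (cases "y = 0")
  case True
  have "inn x 0 = 0"
    using inn_scaleR_right[of x 0 0] by simp
  with True show ?thesis by simp
next
  case False
  let ?n = "(norm y)\<^sup>2" and ?f = "inn x y"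
  \<comment> \<open>The vector is \<open>(norm y)\<^sup>2\<close> times the component of
    \<open>x\<close> orthogonal to \<open>y\<close>; this scaling avoids division.\<close>
  have "0 \<le> inn (?n *\<^sub>R x + (- ?f) *\<^sub>R y) (?n *\<^sub>R x + (- ?f) *\<^sub>R y)"
    by (simp add: inn_self)
  also have "\<dots> = ?n * (?n * (norm x)\<^sup>2 - ?f\<^sup>2)"
    unfolding inn_add inn_add_right inn_scaleR inn_scaleR_right inn_commute[of y x]
    unfolding inn_self
    by (simp add: power2_eq_square algebra_simps)
  finally have "?f\<^sup>2 \<le> (norm x * norm y)\<^sup>2"
    using False by (simp add: zero_le_mult_iff power_mult_distrib mult.commute)
  then show ?thesis
    by (metis abs_le_square_iff abs_of_nonneg mult_nonneg_nonneg norm_ge_zero)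
qed

sublocale inn: bounded_bilinear inn
  by unfold_locales
    (auto simp: inn_add inn_add_right inn_scaleR inn_scaleR_right intro!: exI[of _ 1] Cauchy_Schwarz)

lemma norm_add_squared: "(norm (x + y))\<^sup>2 = (norm x)\<^sup>2 + 2 * inn x y + (norm y)\<^sup>2"
  using inn_commute[of y x] by (simp add: inn_self[symmetric] inn_add inn_add_right)

lemma norm_diff_squared: "(norm (x - y))\<^sup>2 = (norm x)\<^sup>2 - 2 * inn x y + (norm y)\<^sup>2"
  using norm_add_squared[of x "- y"] by (simp add: inn.minus_right)

lemma parallelogram: "(norm (x + y :: 'h))\<^sup>2 + (norm (x - y))\<^sup>2 = 2 * (norm x)\<^sup>2 + 2 * (norm y)\<^sup>2"
  by (simp add: norm_add_squared norm_diff_squared)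

section \<open>Orthogonal projections onto closed subspaces\<close>

lemma closest_point_exists:
  fixes S :: "'h set"
  assumes "subspace S" "closed S"
  obtains q where "q \<in> S" "\<And>s. s \<in> S \<Longrightarrow> norm (p - q) \<le> norm (p - s)"
proof -
  let ?d = "infdist p S"
  have S: "S \<noteq> {}" using subspace_0[OF assms(1)] by blast
  have lower: "?d \<le> norm (p - s)" if "s \<in> S" for s
    using infdist_le[OF that, of p] by (simp add: dist_norm)
  have "\<exists>s\<in>S. norm (p - s) < ?d + 1 / Suc n" for n
  proof -
    have "(INF s\<in>S. dist p s) < ?d + 1 / Suc n"
      using S by (simp add: infdist_notempty)
    then show ?thesis
      using S by (subst (asm) cINF_less_iff) (auto simp: dist_norm intro: bdd_belowI2[of _ 0])
  qed
  then obtain s where s: "\<And>n. s n \<in> S" "\<And>n. norm (p - s n) < ?d + 1 / Suc n"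
    by metis
  \<comment> \<open>The midpoint of \<open>s m\<close> and \<open>s n\<close> lies in
    \<open>S\<close>, so its distance from \<open>p\<close> is at least \<open>?d\<close>; the
    parallelogram law then makes any minimizing sequence Cauchy.\<close>
  have est: "(norm (s m - s n))\<^sup>2 \<le> 2 * (norm (p - s m))\<^sup>2 + 2 * (norm (p - s n))\<^sup>2 - 4 * ?d\<^sup>2" for m n
  proof -
    have "(1/2) *\<^sub>R (s m + s n) \<in> S"
      using assms(1) s(1) by (intro subspace_scale subspace_add)
    then have "?d \<le> norm (p - (1/2) *\<^sub>R (s m + s n))" by (rule lower)
    then have "(2 * ?d)\<^sup>2 \<le> (2 * norm (p - (1/2) *\<^sub>R (s m + s n)))\<^sup>2"
      by (intro power_mono) (auto simp: infdist_nonneg)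
    also have "2 * norm (p - (1/2) *\<^sub>R (s m + s n)) = norm (2 *\<^sub>R (p - (1/2) *\<^sub>R (s m + s n)))"
      by simp
    also have "2 *\<^sub>R (p - (1/2) *\<^sub>R (s m + s n)) = (p - s m) + (p - s n)"
      by (simp add: algebra_simps scaleR_2)
    finally show ?thesis
      using parallelogram[of "p - s m" "p - s n"]
      by (simp add: power2_eq_square norm_minus_commute)
  qed
  have lim: "(\<lambda>n. norm (p - s n)) \<longlonglongrightarrow> ?d"
  proof (rule tendsto_sandwich[of "\<lambda>_. ?d" _ _ "\<lambda>n. ?d + 1 / Suc n"])
    show "(\<lambda>n. ?d + 1 / Suc n) \<longlonglongrightarrow> ?d"
      using tendsto_add[OF tendsto_const LIMSEQ_Suc[OF lim_1_over_n], of ?d] by simp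
    show "\<forall>\<^sub>F n in sequentially. norm (p - s n) \<le> ?d + 1 / Suc n"
      using less_imp_le[OF s(2)] by (intro always_eventually allI)
  qed (simp_all add: lower s(1))
  have "Cauchy s"
  proof (rule CauchyI)
    fix e :: real assume e: "0 < e"
    have "(\<lambda>n. (norm (p - s n))\<^sup>2) \<longlonglongrightarrow> ?d\<^sup>2"
      using lim by (intro tendsto_intros)
    \<comment> \<open>The margin \<open>e\<^sup>2 / 4\<close> is what \<open>est\<close> requires:
      two terms \<open>2 * (?d\<^sup>2 + e\<^sup>2 / 4)\<close> minus \<open>4 * ?d\<^sup>2\<close>
      leave \<open>e\<^sup>2\<close>.\<close>
    then have "\<forall>\<^sub>F n in sequentially. (norm (p - s n))\<^sup>2 < ?d\<^sup>2 + e\<^sup>2 / 4"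
      using e by (intro order_tendstoD) auto
    then obtain N where N: "\<And>n. n \<ge> N \<Longrightarrow> (norm (p - s n))\<^sup>2 < ?d\<^sup>2 + e\<^sup>2 / 4"
      by (auto simp: eventually_sequentially)
    show "\<exists>M. \<forall>m\<ge>M. \<forall>n\<ge>M. norm (s m - s n) < e"
    proof (intro exI allI impI)
      fix m n assume "N \<le> m" "N \<le> n"
      then have "(norm (s m - s n))\<^sup>2 < e\<^sup>2"
        using est[of m n] N[of m] N[of n] by simp
      then show "norm (s m - s n) < e"
        using e by (simp add: power_less_imp_less_base)
    qed
  qed
  then obtain q where q: "s \<longlonglongrightarrow> q"
    by (auto simp: Cauchy_convergent_iff convergent_def)
  show ?thesis
  proof
    show "q \<in> S" using closed_sequentially[OF assms(2)] s(1) q by blast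
    have "(\<lambda>n. norm (p - s n)) \<longlonglongrightarrow> norm (p - q)"
      using q by (intro tendsto_intros)
    then have "norm (p - q) = ?d" using lim LIMSEQ_unique by blast
    then show "norm (p - q) \<le> norm (p - t)" if "t \<in> S" for t using lower[OF that] by simp
  qed
qed

lemma orthogonal_projection_exists:
  assumes "subspace S" "closed S"
  obtains q where "q \<in> S" "\<And>s. s \<in> S \<Longrightarrow> inn (p - q) s = 0"
proof -
  obtain q where q: "q \<in> S" and min: "\<And>s. s \<in> S \<Longrightarrow> norm (p - q) \<le> norm (p - s)"
    using closest_point_exists[OF assms] by metis
  have "inn (p - q) s = 0" if s: "s \<in> S" for s
  proof (cases "s = 0")
    case False
    \<comment> \<open>This \<open>t\<close> minimizes the norm of
      \<open>(p - q) - t *\<^sub>R s\<close>; it would beat the closest point \<open>q\<close>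
      unless the inner product is zero.\<close>
    define t where "t = inn (p - q) s / (norm s)\<^sup>2"
    have "q + t *\<^sub>R s \<in> S" using assms(1) q s by (intro subspace_add subspace_scale)
    from min[OF this] have "(norm (p - q))\<^sup>2 \<le> (norm ((p - q) - t *\<^sub>R s))\<^sup>2"
      by (simp add: diff_diff_eq power_mono)
    also have "\<dots> = (norm (p - q))\<^sup>2 - 2 * (t * inn (p - q) s) + t\<^sup>2 * (norm s)\<^sup>2"
      by (simp add: norm_diff_squared inn.scaleR_right power_mult_distrib)
    also have "\<dots> = (norm (p - q))\<^sup>2 - (inn (p - q) s)\<^sup>2 / (norm s)\<^sup>2"
      using False by (simp add: t_def power2_eq_square field_simps)
    finally show ?thesis using False by (simp add: divide_le_0_iff)
  qed (simp add: inn.zero_right)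
  with q show ?thesis using that by blast
qed

text \<open>The residual of projecting any vector onto the closure of \<open>S\<close> is orthogonal
  to \<open>S\<close>, hence zero.\<close>

lemma dense_if_orthogonal_trivial:
  assumes "subspace S" "\<And>p. (\<And>s. s \<in> S \<Longrightarrow> inn p s = 0) \<Longrightarrow> p = 0"
  shows "closure S = UNIV"
proof -
  have "p \<in> closure S" for p
  proof -
    obtain q where q: "q \<in> closure S" "\<And>s. s \<in> closure S \<Longrightarrow> inn (p - q) s = 0"
      using orthogonal_projection_exists[OF subspace_closure[OF assms(1)] closed_closure] by metis
    then have "p - q = 0" using closure_subset[of S] by (intro assms(2)) auto
    with q(1) show ?thesis by simp
  qed
  then show ?thesis by auto
qed

lemma orthogonal_dense_eq_0:
  assumes "closure D = UNIV" "\<And>x. x \<in> D \<Longrightarrow> inn x y = 0"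
  shows "y = 0"
proof -
  have "closed {x. inn x y = 0}"
    by (intro closed_Collect_eq continuous_intros inn.continuous_on)
  then have "closure D \<subseteq> {x. inn x y = 0}"
    using assms(2) by (intro closure_minimal) auto
  then have "inn y y = 0" using assms(1) by auto
  then show ?thesis by (simp add: inn_self)
qed

text \<open>The norm on pairs is Euclidean, so pairs form a Hilbert space. They serve both as points
  of graphs and as vectors \<open>x + iy\<close> of the complexification.\<close>

lemma real_hilbert_prod: "real_hilbert (\<lambda>p q. inn (fst p) (fst q) + inn (snd p) (snd q))"
proof
  fix x y :: "'h \<times> 'h"
  show "inn (fst x) (fst y) + inn (snd x) (snd y) = inn (fst y) (fst x) + inn (snd y) (snd x)"
    using inn_commute by metis
qed (simp_all add: inn_add inn_scaleR distrib_left inn_self norm_prod_def)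

section \<open>Adjoints of linear relations\<close>

text \<open>Working with relations makes the adjoint available without density or single-valuedness.
  For the graph of a densely defined operator this is the graph of its adjoint with respect to
  \<open>inn\<close>.\<close>

definition adjoint_rel :: "('h \<times> 'h) set \<Rightarrow> ('h \<times> 'h) set"
  where "adjoint_rel G = {(y, z). \<forall>(x, x')\<in>G. inn x' y = inn x z}"

lemma adjoint_relI: "(\<And>x x'. (x, x') \<in> G \<Longrightarrow> inn x' y = inn x z) \<Longrightarrow> (y, z) \<in> adjoint_rel G"
  by (auto simp: adjoint_rel_def)

lemma adjoint_relD: "(y, z) \<in> adjoint_rel G \<Longrightarrow> (x, x') \<in> G \<Longrightarrow> inn x' y = inn x z"
  by (auto simp: adjoint_rel_def)

lemma closed_adjoint_rel: "closed (adjoint_rel G)"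
proof -
  have "adjoint_rel G = (\<Inter>p\<in>G. {q. inn (snd p) (fst q) = inn (fst p) (snd q)})"
    by (fastforce simp: adjoint_rel_def)
  then show ?thesis
    by (auto intro!: closed_Collect_eq continuous_intros inn.continuous_on)
qed

lemma adjoint_rel_closure: "adjoint_rel (closure G) = adjoint_rel G"
proof
  show "adjoint_rel (closure G) \<subseteq> adjoint_rel G"
    using closure_subset[of G] by (auto simp: adjoint_rel_def)
  show "adjoint_rel G \<subseteq> adjoint_rel (closure G)"
  proof (rule subrelI)
    fix y z assume yz: "(y, z) \<in> adjoint_rel G"
    have "closed {p. inn (snd p) y = inn (fst p) z}"
      by (intro closed_Collect_eq continuous_intros inn.continuous_on)
    then have "closure G \<subseteq> {p. inn (snd p) y = inn (fst p) z}"
      using yz by (intro closure_minimal) (auto dest: adjoint_relD)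
    then show "(y, z) \<in> adjoint_rel (closure G)" by (auto simp: adjoint_rel_def)
  qed
qed

lemma adjoint_rel_unique:
  assumes dense: "closure (fst ` G) = UNIV"
    and z: "(y, z) \<in> adjoint_rel G" and z': "(y, z') \<in> adjoint_rel G"
  shows "z = z'"
proof -
  have "z - z' = 0"
  proof (rule orthogonal_dense_eq_0[OF dense])
    fix x assume "x \<in> fst ` G"
    then obtain x' where "(x, x') \<in> G" by force
    from adjoint_relD[OF z this] adjoint_relD[OF z' this] show "inn x (z - z') = 0"
      by (simp add: inn.diff_right)
  qed
  then show ?thesis by simp
qed

text \<open>
  The graph is rescaled to \<open>{(bx, Tx)}\<close>: the residual \<open>(s, s')\<close> of projecting a rescaled point of the
  adjoint onto its closure satisfies \<open>T\<^sup>* s = b s'\<close> and \<open>T\<^sup>* s' = - b s\<close>.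
  The hypothesis on \<open>u\<close>, \<open>v\<close> says that \<open>\<i>b\<close> is not an eigenvalue of the complexified adjoint:
  its eigenvectors would be the vectors \<open>u + \<i>v\<close>.
\<close>

lemma adjoint_rel_eq_closure:
  assumes G: "subspace G" and sym: "G \<subseteq> adjoint_rel G" and b: "b \<noteq> 0"
    and deficiency: "\<And>u v. (u, - b *\<^sub>R v) \<in> adjoint_rel G \<Longrightarrow> (v, b *\<^sub>R u) \<in> adjoint_rel G \<Longrightarrow> u = 0 \<and> v = 0"
  shows "adjoint_rel G = closure G"
proof
  show "closure G \<subseteq> adjoint_rel G"
    by (rule closure_minimal[OF sym closed_adjoint_rel])
  show "adjoint_rel G \<subseteq> closure G"
  proof (rule subrelI)
    fix y z assume yz: "(y, z) \<in> adjoint_rel G"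
    interpret P: real_hilbert "\<lambda>p q :: 'h \<times> 'h. inn (fst p) (fst q) + inn (snd p) (snd q)"
      by (rule real_hilbert_prod)
    let ?h = "\<lambda>p :: 'h \<times> 'h. (b *\<^sub>R fst p, snd p)"
    let ?k = "\<lambda>p :: 'h \<times> 'h. ((1/b) *\<^sub>R fst p, snd p)"
    have kh: "?k (?h p) = p" for p using b by simp
    have "linear ?h"
      by (intro linearI) (auto simp: algebra_simps)
    then have "subspace (?h ` G)" using G by (rule linear_subspace_image)
    then have sub: "subspace (closure (?h ` G))" by (rule subspace_closure)
    obtain q where q: "q \<in> closure (?h ` G)"
      and orth: "\<And>p. p \<in> closure (?h ` G) \<Longrightarrow>
        inn (fst (?h (y, z) - q)) (fst p) + inn (snd (?h (y, z) - q)) (snd p) = 0"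
      by (rule P.orthogonal_projection_exists[OF sub closed_closure, of "?h (y, z)"]) blast
    \<comment> \<open>The map \<open>?k\<close> is the continuous inverse of \<open>?h\<close>, so
      it carries the projection \<open>q\<close> back into the closure of \<open>G\<close>.\<close>
    have k_closure: "?k ` closure (?h ` G) \<subseteq> closure (?k ` ?h ` G)"
      by (intro image_closure_subset continuous_intros) (auto simp: closure_subset)
    have kh_image: "?k ` ?h ` G = G"
      unfolding image_image kh by simp
    have kq: "?k q \<in> closure G"
      using subsetD[OF k_closure imageI[OF q]] unfolding kh_image .
    define r where "r = ?h (y, z) - q"
    have 1: "(snd r, - b *\<^sub>R fst r) \<in> adjoint_rel G"
    proof (rule adjoint_relI)
      fix x x' assume "(x, x') \<in> G"
      then have "?h (x, x') \<in> closure (?h ` G)"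
        by (intro subsetD[OF closure_subset] imageI)
      from orth[OF this] have "inn (fst r) (b *\<^sub>R x) + inn (snd r) x' = 0"
        by (simp add: r_def)
      then show "inn x' (snd r) = inn x (- b *\<^sub>R fst r)"
        unfolding inn_commute[of x] inn_commute[of x']
        by (simp add: inn.scaleR_right inn.scaleR_left inn.minus_left)
    qed
    \<comment> \<open>Both \<open>(y, z)\<close> and \<open>?k q\<close> belong to the adjoint;
      \<open>b\<close> times their difference is \<open>(fst r, b *\<^sub>R snd r)\<close>, which is
      the second eigenvector equation.\<close>
    have "?k q \<in> adjoint_rel G"
      using kq closure_minimal[OF sym closed_adjoint_rel] by blast
    then have "inn x' (fst q) = b * inn x (snd q)" if "(x, x') \<in> G" for x x'
      using adjoint_relD[OF _ that, of "(1/b) *\<^sub>R fst q" "snd q"] b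
      by (simp add: inn.scaleR_right field_simps)
    then have 2: "(fst r, b *\<^sub>R snd r) \<in> adjoint_rel G"
      by (intro adjoint_relI)
        (simp add: r_def inn.diff_right inn.scaleR_right adjoint_relD[OF yz] right_diff_distrib)
    have "r = 0" using deficiency[OF 1 2] by (simp add: prod_eq_iff)
    then have "q = ?h (y, z)" by (simp only: r_def right_minus_eq)
    with kq show "(y, z) \<in> closure G" using b by simp
  qed
qed

text \<open>The set is the range of \<open>A + ib\<close> on the complexification, \<open>G\<close>
  being the graph of \<open>A\<close>. A vector orthogonal to it is an eigenvector of the adjoint
  for \<open>ib\<close>; since the adjoint equals the closure of \<open>G\<close>, it is symmetric
  and has no such eigenvector.\<close>

lemma range_dense_if_adjoint_rel_eq_closure:
  assumes G: "subspace G" and adj: "adjoint_rel G = closure G" and b: "b \<noteq> 0"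
  shows "closure ((\<lambda>((x, x'), (y, y')). (x' - b *\<^sub>R y, y' + b *\<^sub>R x)) ` (G \<times> G)) = UNIV"
    (is "closure (?h ` _) = UNIV")
proof -
  interpret P: real_hilbert "\<lambda>p q :: 'h \<times> 'h. inn (fst p) (fst q) + inn (snd p) (snd q)"
    by (rule real_hilbert_prod)
  have "linear ?h" by (intro linearI) (auto simp: algebra_simps)
  moreover have "subspace (G \<times> G)" using G G by (rule subspace_Times)
  ultimately have "subspace (?h ` (G \<times> G))" by (rule linear_subspace_image)
  then show ?thesis
  proof (rule P.dense_if_orthogonal_trivial)
    fix p assume *: "\<And>s. s \<in> ?h ` (G \<times> G) \<Longrightarrow> inn (fst p) (fst s) + inn (snd p) (snd s) = 0"
    then have orth: "inn (fst p) (x' - b *\<^sub>R y) + inn (snd p) (y' + b *\<^sub>R x) = 0"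
      if "(x, x') \<in> G" "(y, y') \<in> G" for x x' y y'
      using *[OF imageI, of "((x, x'), (y, y'))"] that by simp
    have zero: "(0, 0) \<in> G" using subspace_0[OF G] by (simp add: zero_prod_def)
    have 1: "(fst p, - b *\<^sub>R snd p) \<in> adjoint_rel G"
    proof (rule adjoint_relI)
      fix x x' assume "(x, x') \<in> G"
      from orth[OF this zero] show "inn x' (fst p) = inn x (- b *\<^sub>R snd p)"
        by (simp add: inn.scaleR_right inn.minus_right inn.zero_right inn_commute)
    qed
    have 2: "(snd p, b *\<^sub>R fst p) \<in> adjoint_rel G"
    proof (rule adjoint_relI)
      fix x x' assume "(x, x') \<in> G"
      from orth[OF zero this] show "inn x' (snd p) = inn x (b *\<^sub>R fst p)"
        by (simp add: inn.scaleR_right inn.minus_right inn.zero_right inn_commute)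
    qed
    \<comment> \<open>One eigenvector equation is read in the adjoint and the other in the closure
      of \<open>G\<close>. Pairing them equates a nonpositive and a nonnegative multiple of
      \<open>b\<close>.\<close>
    have "(snd p, b *\<^sub>R fst p) \<in> adjoint_rel (closure G)"
      using 2 by (simp add: adjoint_rel_closure)
    moreover have "(fst p, - b *\<^sub>R snd p) \<in> closure G"
      using 1 adj by simp
    ultimately have "inn (- b *\<^sub>R snd p) (snd p) = inn (fst p) (b *\<^sub>R fst p)"
      by (rule adjoint_relD)
    then have "b * ((norm (fst p))\<^sup>2 + (norm (snd p))\<^sup>2) = 0"
      by (simp add: inn.scaleR_left inn.scaleR_right inn.minus_left inn_self distrib_left)
    then show "p = 0"
      using b by (simp add: prod_eq_iff sum_power2_eq_zero_iff)
  qed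
qed

text \<open>In the proof, \<open>a x y\<close> and \<open>t x y\<close> are \<open>(A + \<i>b)z\<close> and \<open>(T + \<i>b)z\<close> for \<open>z = x + \<i>y\<close>.\<close>

lemma deficiency_trivial:
  fixes A T :: "'h \<Rightarrow> 'h"
  assumes G: "subspace ((\<lambda>x. (x, A x)) ` D)" and dense: "closure D = UNIV"
    and adj: "adjoint_rel ((\<lambda>x. (x, A x)) ` D) = closure ((\<lambda>x. (x, A x)) ` D)"
    and symA: "\<And>x y. x \<in> D \<Longrightarrow> y \<in> D \<Longrightarrow> inn (A x) y = inn x (A y)"
    and symT: "\<And>x y. x \<in> D \<Longrightarrow> y \<in> D \<Longrightarrow> inn (T x) y = inn x (T y)"
    and b: "b > 0"
    and lower: "\<And>x. x \<in> D \<Longrightarrow> - (b\<^sup>2 / 2) * (norm x)\<^sup>2 \<le> inn (A x) (T x)"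
    and \<alpha>: "\<alpha> \<ge> 0" and \<beta>: "\<beta> \<ge> 0"
    and bound: "\<And>x. x \<in> D \<Longrightarrow> (norm (T x))\<^sup>2 \<le> \<alpha> * (norm (A x))\<^sup>2 + \<beta> * (norm x)\<^sup>2"
    and u: "(u, - b *\<^sub>R v) \<in> adjoint_rel ((\<lambda>x. (x, T x)) ` D)"
    and v: "(v, b *\<^sub>R u) \<in> adjoint_rel ((\<lambda>x. (x, T x)) ` D)"
  shows "u = 0 \<and> v = 0"
proof -
  interpret P: real_hilbert "\<lambda>p q :: 'h \<times> 'h. inn (fst p) (fst q) + inn (snd p) (snd q)"
    by (rule real_hilbert_prod)
  define P where "P = (\<lambda>p q :: 'h \<times> 'h. inn (fst p) (fst q) + inn (snd p) (snd q))"
  define a where "a = (\<lambda>x y. (A x - b *\<^sub>R y, A y + b *\<^sub>R x))"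
  define t where "t = (\<lambda>x y. (T x - b *\<^sub>R y, T y + b *\<^sub>R x))"
  \<comment> \<open>\<open>K\<close> dominates both \<open>\<alpha>\<close> and
    \<open>(\<beta> + b\<^sup>2) / b\<^sup>2\<close>, the factors needed to compare the two parts of
    the bound for \<open>t\<close> with those of \<open>(norm (a x y))\<^sup>2\<close>.\<close>
  define K where "K = \<alpha> + (\<beta> + b\<^sup>2) / b\<^sup>2"
  have K: "K \<ge> 0" using \<alpha> \<beta> by (simp add: K_def)
  have norm_pair: "(norm (p :: 'h \<times> 'h))\<^sup>2 = (norm (fst p))\<^sup>2 + (norm (snd p))\<^sup>2" for p
    by (simp add: norm_prod_def)
  have coercive: "b\<^sup>2 / 2 * (norm (x, y))\<^sup>2 \<le> P (t x y) (a x y)" if "x \<in> D" "y \<in> D" for x y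
  proof -
    \<comment> \<open>The terms linear in \<open>b\<close> cancel by symmetry of \<open>A\<close>
      and \<open>T\<close>. Of the remaining \<open>b\<^sup>2\<close>, the bound
      \<open>lower\<close> uses up one half.\<close>
    have "P (t x y) (a x y) = inn (A x) (T x) + inn (A y) (T y) + b\<^sup>2 * (norm (x, y))\<^sup>2"
      using symA[of x y] symT[of x y] that unfolding norm_pair
      by (simp add: P_def t_def a_def inn.diff_left inn.diff_right inn.add_left inn.add_right
          inn.scaleR_left inn.scaleR_right inn_self power2_eq_square algebra_simps
          inn_commute[of y "A x"] inn_commute[of "T x" "A x"] inn_commute[of "T y" "A y"]
          inn_commute[of "T y" x])
    then show ?thesis
      using lower[OF that(1)] lower[OF that(2)] by (simp add: norm_pair algebra_simps)
  qed
  have orth: "P (t x y) (u, v) = 0" if "x \<in> D" "y \<in> D" for x y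
    using adjoint_relD[OF u, of x "T x"] adjoint_relD[OF v, of y "T y"] that
    by (simp add: P_def t_def inn.diff_left inn.add_left inn.scaleR_left inn.scaleR_right inn.minus_right)
  have norm_t: "norm (t x y) \<le> sqrt K * norm (a x y)" if "x \<in> D" "y \<in> D" for x y
  proof -
    let ?n = "(norm x)\<^sup>2 + (norm y)\<^sup>2" and ?m = "(norm (A x))\<^sup>2 + (norm (A y))\<^sup>2"
    \<comment> \<open>Symmetry of \<open>F\<close> removes the cross terms:
      \<open>|(F + ib)z|^2 = |Fz|^2 + b^2 |z|^2\<close>.\<close>
    have *: "(norm (F x - b *\<^sub>R y, F y + b *\<^sub>R x))\<^sup>2 = (norm (F x))\<^sup>2 + (norm (F y))\<^sup>2 + b\<^sup>2 * ?n"
      if "inn (F x) y = inn x (F y)" for F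
      using that by (simp add: norm_pair norm_add_squared norm_diff_squared inn.scaleR_right
          power_mult_distrib algebra_simps inn_commute[of x "F y"])
    have "(norm (t x y))\<^sup>2 = (norm (T x))\<^sup>2 + (norm (T y))\<^sup>2 + b\<^sup>2 * ?n"
      unfolding t_def by (rule *) (rule symT[OF that])
    also have "\<dots> \<le> \<alpha> * ?m + (\<beta> + b\<^sup>2) * ?n"
      using bound[OF that(1)] bound[OF that(2)] by (simp add: algebra_simps)
    also have "\<dots> \<le> K * ?m + K * (b\<^sup>2 * ?n)"
    proof (rule add_mono)
      show "\<alpha> * ?m \<le> K * ?m"
        using \<beta> by (intro mult_right_mono) (auto simp: K_def)
      have "(\<beta> + b\<^sup>2) \<le> K * b\<^sup>2"
        using \<alpha> b by (simp add: K_def field_simps)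
      then have "(\<beta> + b\<^sup>2) * ?n \<le> (K * b\<^sup>2) * ?n" by (intro mult_right_mono) auto
      then show "(\<beta> + b\<^sup>2) * ?n \<le> K * (b\<^sup>2 * ?n)" by (simp only: mult.assoc)
    qed
    also have "\<dots> = K * (norm (a x y))\<^sup>2"
      unfolding a_def *[OF symA[OF that]] by (simp only: distrib_left)
    finally have "(norm (t x y))\<^sup>2 \<le> (sqrt K * norm (a x y))\<^sup>2"
      using K by (simp add: power_mult_distrib)
    then show ?thesis
      using K by (intro power2_le_imp_le[of "norm (t x y)"]) auto
  qed
  have "(u, v) \<in> closure ((\<lambda>((x, x'), (y, y')). (x' - b *\<^sub>R y, y' + b *\<^sub>R x)) `
      ((\<lambda>x. (x, A x)) ` D \<times> (\<lambda>x. (x, A x)) ` D))"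
    using range_dense_if_adjoint_rel_eq_closure[OF G adj, of b] b by simp
  then obtain f where f: "\<And>n. f n \<in> (\<lambda>((x, x'), (y, y')). (x' - b *\<^sub>R y, y' + b *\<^sub>R x)) `
      ((\<lambda>x. (x, A x)) ` D \<times> (\<lambda>x. (x, A x)) ` D)" "f \<longlonglongrightarrow> (u, v)"
    unfolding closure_sequential by blast
  have "\<exists>x y. x \<in> D \<and> y \<in> D \<and> f n = a x y" for n
    using f(1)[of n] by (auto simp: a_def)
  then obtain x y where x: "\<And>n. x n \<in> D" and y: "\<And>n. y n \<in> D" and f_eq: "\<And>n. f n = a (x n) (y n)"
    by metis
  have le: "b\<^sup>2 / 2 * (norm (x n, y n))\<^sup>2 \<le> sqrt K * norm (f n) * norm (f n - (u, v))" for n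
  proof -
    let ?t = "t (x n) (y n)"
    have "b\<^sup>2 / 2 * (norm (x n, y n))\<^sup>2 \<le> P ?t (f n)"
      using coercive[OF x y] f_eq by simp
    \<comment> \<open>Orthogonality of \<open>(u, v)\<close> to the range of \<open>T + ib\<close>
      allows it to be subtracted, which creates a factor tending to zero.\<close>
    also have "\<dots> = P ?t (f n - (u, v))"
      using orth[OF x y, of n n] P.inn.diff_right[of ?t "f n" "(u, v)"] by (simp add: P_def)
    also have "\<dots> \<le> norm ?t * norm (f n - (u, v))"
      using P.Cauchy_Schwarz[of ?t "f n - (u, v)"] unfolding P_def by linarith
    also have "\<dots> \<le> sqrt K * norm (f n) * norm (f n - (u, v))"
      using norm_t[OF x y, of n n] f_eq by (intro mult_right_mono) auto
    finally show ?thesis .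
  qed
  have lim: "(\<lambda>n. sqrt K * norm (f n) * norm (f n - (u, v))) \<longlonglongrightarrow> sqrt K * norm (u, v) * norm ((u, v) - (u, v))"
    by (intro tendsto_mult tendsto_norm tendsto_diff tendsto_const f(2))
  have "(\<lambda>n. b\<^sup>2 / 2 * (norm (x n, y n))\<^sup>2) \<longlonglongrightarrow> 0"
  proof (rule tendsto_sandwich[OF _ _ tendsto_const])
    show "(\<lambda>n. sqrt K * norm (f n) * norm (f n - (u, v))) \<longlonglongrightarrow> 0"
      using lim by simp
    show "\<forall>\<^sub>F n in sequentially. b\<^sup>2 / 2 * (norm (x n, y n))\<^sup>2 \<le> sqrt K * norm (f n) * norm (f n - (u, v))"
      using le by (intro always_eventually allI)
  qed simp
  then have "(\<lambda>n. 2 / b\<^sup>2 * (b\<^sup>2 / 2 * (norm (x n, y n))\<^sup>2)) \<longlonglongrightarrow> 2 / b\<^sup>2 * 0"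
    by (intro tendsto_mult tendsto_const)
  then have "(\<lambda>n. sqrt ((norm (x n, y n))\<^sup>2)) \<longlonglongrightarrow> sqrt 0"
    using b by (intro tendsto_real_sqrt) simp
  then have "(\<lambda>n. (x n, y n)) \<longlonglongrightarrow> (0, 0)"
    by (simp add: tendsto_norm_zero_iff flip: zero_prod_def)
  then have xy0: "x \<longlonglongrightarrow> 0" "y \<longlonglongrightarrow> 0"
    by (auto dest: tendsto_fst tendsto_snd)
  have f1: "(\<lambda>n. A (x n) - b *\<^sub>R y n) \<longlonglongrightarrow> u" and f2: "(\<lambda>n. A (y n) + b *\<^sub>R x n) \<longlonglongrightarrow> v"
    using tendsto_fst[OF f(2)] tendsto_snd[OF f(2)] by (simp_all add: f_eq a_def)
  \<comment> \<open>\<open>A\<close> need not be continuous, so symmetry moves it onto the fixed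
    vector \<open>e\<close> before \<open>x n\<close> and \<open>y n\<close> tend to zero.\<close>
  have "inn e u = 0" "inn e v = 0" if e: "e \<in> D" for e
  proof -
    have "(\<lambda>n. inn (A e) (x n) - b * inn e (y n)) \<longlonglongrightarrow> inn (A e) 0 - b * inn e 0"
      by (intro tendsto_intros inn.tendsto xy0)
    also have "(\<lambda>n. inn (A e) (x n) - b * inn e (y n)) = (\<lambda>n. inn e (A (x n) - b *\<^sub>R y n))"
      using symA[OF e x] by (simp add: inn.diff_right inn.scaleR_right)
    finally show "inn e u = 0"
      using inn.tendsto[OF tendsto_const f1, of e] LIMSEQ_unique by (fastforce simp: inn.zero_right)
    have "(\<lambda>n. inn (A e) (y n) + b * inn e (x n)) \<longlonglongrightarrow> inn (A e) 0 + b * inn e 0"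
      by (intro tendsto_intros inn.tendsto xy0)
    also have "(\<lambda>n. inn (A e) (y n) + b * inn e (x n)) = (\<lambda>n. inn e (A (y n) + b *\<^sub>R x n))"
      using symA[OF e y] by (simp add: inn.add_right inn.scaleR_right)
    finally show "inn e v = 0"
      using inn.tendsto[OF tendsto_const f2, of e] LIMSEQ_unique by (fastforce simp: inn.zero_right)
  qed
  then show ?thesis
    using orthogonal_dense_eq_0[OF dense] by blast
qed

end

section \<open>The real form of a Hilbert space\<close>

lemma conj_0 [simp]: "conj (0 :: 'k::real_or_complex) = 0"
  using conj_add[of "0 :: 'k" 0] by simp

lemma conj_of_real [simp]: "conj (of_real r :: 'k::real_or_complex) = of_real r"
proof (cases "r = 0")
  case False
  have "(of_real r :: 'k) * conj (of_real r) = of_real r * of_real r"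
    by (simp add: mult_conj power2_eq_square)
  with False show ?thesis by simp
qed simp

text \<open>Multiplicativity of \<open>conj\<close> is not an axiom of the class; real factors come
  out because \<open>z * conj z\<close> is prescribed and nonzero \<open>z\<close> can be
  cancelled.\<close>

lemma conj_of_real_mult: "conj (of_real r * z) = of_real r * conj z" for z :: "'k::real_or_complex"
proof (cases "of_real r * z = 0")
  case False
  have "(norm (of_real r * z))\<^sup>2 = r * r * (norm z)\<^sup>2"
    by (simp add: norm_mult power_mult_distrib power2_eq_square)
  then have "(of_real r * z) * conj (of_real r * z) = of_real (r * r * (norm z)\<^sup>2)"
    by (simp only: mult_conj)
  also have "\<dots> = (of_real r * z) * (of_real r * conj z)"
    unfolding of_real_mult mult_conj[of z, symmetric] by (simp only: ac_simps)
  finally have "(of_real r * z) * conj (of_real r * z) = (of_real r * z) * (of_real r * conj z)" .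
  then show ?thesis unfolding mult_left_cancel[OF False] .
qed auto

text \<open>This is the real part of \<open>ip x y\<close>, by polarization. Written through the
  norm alone, it is a real number for either scalar field.\<close>

definition polar_form :: "'h::real_normed_vector \<Rightarrow> 'h \<Rightarrow> real"
  where "polar_form x y = ((norm (x + y))\<^sup>2 - (norm (x - y))\<^sup>2) / 4"

context hilbert_space
begin

lemma ip_add_right: "ip z (x + y) = ip z x + ip z y"
  by (metis ip_add_left ip_commute conj_add)

lemma ip_minus_left: "ip (- x) y = - ip x y"
  using ip_scale_left[of "-1" x y] scale_of_real[of "-1" x] by simp

lemma ip_minus_right: "ip y (- x) = - ip y x"
proof -
  have "ip y (- x) + ip y x = ip y 0" by (simp flip: ip_add_right)
  also have "\<dots> = 0" using ip_add_right[of y 0 0] by simp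
  finally show ?thesis by (simp add: eq_neg_iff_add_eq_0)
qed

text \<open>This is the bridge between the two forms: identities for \<open>polar_form\<close> can
  be checked in the scalar field and pulled back, because \<open>of_real\<close> is
  injective.\<close>

lemma of_real_polar_form: "of_real (2 * polar_form x y) = ip x y + ip y x"
proof -
  have plus: "of_real ((norm (x + y))\<^sup>2) = ip x x + ip x y + ip y x + ip y y"
    by (simp only: ip_self[symmetric] ip_add_left ip_add_right add_ac)
  have minus: "of_real ((norm (x - y))\<^sup>2) = ip x x - ip x y - ip y x + ip y y"
    unfolding ip_self[symmetric]
    using ip_add_left[of x "- y"] ip_add_right[of _ x "- y"]
    by (simp add: ip_minus_left ip_minus_right)
  have "of_real (2 * polar_form x y) = (of_real ((norm (x + y))\<^sup>2) - of_real ((norm (x - y))\<^sup>2)) / (2 :: 'k)"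
    by (simp add: polar_form_def)
  also have "\<dots> = ip x y + ip y x"
    unfolding plus minus by (simp add: field_simps)
  finally show ?thesis .
qed

sublocale real: real_hilbert "polar_form :: 'h \<Rightarrow> 'h \<Rightarrow> real"
proof
  fix x y z :: 'h and r :: real
  have "of_real (2 * polar_form (x + y) z) = (of_real (2 * polar_form x z + 2 * polar_form y z) :: 'k)"
    unfolding of_real_add of_real_polar_form by (simp add: ip_add_left ip_add_right)
  then show "polar_form (x + y) z = polar_form x z + polar_form y z"
    by (simp only: of_real_eq_iff)
  have "ip y (r *\<^sub>R x) = conj (of_real r * ip x y)"
    unfolding scale_of_real[symmetric] by (subst ip_commute) (simp only: ip_scale_left)
  then have right: "ip y (r *\<^sub>R x) = of_real r * ip y x"
    unfolding conj_of_real_mult ip_commute[of y x] .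
  have "of_real (2 * polar_form (r *\<^sub>R x) y) = (of_real (r * (2 * polar_form x y)) :: 'k)"
    unfolding of_real_mult[of r] of_real_polar_form right
    by (simp add: ip_scale_left distrib_left flip: scale_of_real)
  then show "polar_form (r *\<^sub>R x) y = r * polar_form x y"
    by (simp only: of_real_eq_iff)
  show "polar_form x y = polar_form y x"
    by (simp add: polar_form_def add.commute norm_minus_commute)
  show "polar_form x x = (norm x)\<^sup>2"
    by (simp add: polar_form_def power_mult_distrib flip: scaleR_2)
qed

lemma norm_smul: "norm (smul c x) = norm c * norm x"
proof (cases "x = 0")
  case False
  have "of_real ((norm (smul c x))\<^sup>2) = c * ip x (smul c x)"
    by (simp only: ip_self[symmetric] ip_scale_left)
  also have "ip x (smul c x) = conj (of_real ((norm x)\<^sup>2) * c)"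
    by (subst ip_commute) (simp only: ip_scale_left ip_self mult.commute)
  also have "\<dots> = of_real ((norm x)\<^sup>2) * conj c"
    by (rule conj_of_real_mult)
  also have "c * (of_real ((norm x)\<^sup>2) * conj c) = of_real ((norm x)\<^sup>2 * (norm c)\<^sup>2)"
    unfolding of_real_mult mult_conj[of c, symmetric] by (simp only: ac_simps)
  finally have "(norm (smul c x))\<^sup>2 = (norm c * norm x)\<^sup>2"
    by (simp only: of_real_eq_iff power_mult_distrib mult.commute)
  then show ?thesis by (simp add: power2_eq_iff_nonneg)
qed simp

text \<open>Continuity of \<open>smul c\<close> extends the invariance of a graph under scalars to
  its closure.\<close>

lemma bounded_linear_smul: "bounded_linear (smul c)"
proof (rule bounded_linear_intro[of _ "norm c"])
  show "smul c (r *\<^sub>R x) = r *\<^sub>R smul c x" for r x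
    unfolding scale_of_real[symmetric] by (rule scale_left_commute)
qed (auto simp: scale_right_distrib norm_smul mult.commute)

text \<open>An identity of real parts on a set invariant under scalars is a full identity: with
  \<open>d = ip x' y - ip x z\<close>, multiplying \<open>x\<close> and \<open>x'\<close> by
  \<open>conj d\<close> turns the difference into \<open>|d|^2\<close>, which its vanishing real
  part forces to be zero.\<close>

lemma adjoint_rel_iff_ip:
  assumes "\<And>c x x'. (x, x') \<in> S \<Longrightarrow> (smul c x, smul c x') \<in> S"
  shows "(y, z) \<in> real.adjoint_rel S \<longleftrightarrow> (\<forall>(x, x')\<in>S. ip x' y = ip x z)"
proof
  assume R: "\<forall>(x, x')\<in>S. ip x' y = ip x z"
  show "(y, z) \<in> real.adjoint_rel S"
  proof (rule real.adjoint_relI)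
    fix x x' assume "(x, x') \<in> S"
    with R have "ip x' y = ip x z" by blast
    then have "of_real (2 * polar_form x' y) = (of_real (2 * polar_form x z) :: 'k)"
      unfolding of_real_polar_form using ip_commute by metis
    then show "polar_form x' y = polar_form x z"
      by (simp only: of_real_eq_iff)
  qed
next
  assume L: "(y, z) \<in> real.adjoint_rel S"
  show "\<forall>(x, x')\<in>S. ip x' y = ip x z"
  proof clarify
    fix x x' assume S: "(x, x') \<in> S"
    define d where "d = ip x' y - ip x z"
    define c where "c = conj d"
    have cd: "c * d = of_real ((norm d)\<^sup>2)"
      unfolding c_def using mult_conj[of d] by (simp only: mult.commute)
    have "ip (smul c x') y - ip (smul c x) z = of_real ((norm d)\<^sup>2)"
      unfolding ip_scale_left cd[symmetric] by (simp add: d_def algebra_simps)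
    then have left: "ip (smul c x') y = ip (smul c x) z + of_real ((norm d)\<^sup>2)"
      by (simp add: algebra_simps)
    have "polar_form (smul c x') y = polar_form (smul c x) z"
      by (rule real.adjoint_relD[OF L assms[OF S]])
    then have "ip (smul c x') y + ip y (smul c x') = ip (smul c x) z + ip z (smul c x)"
      by (simp only: of_real_polar_form[symmetric])
    moreover have "ip y (smul c x') = conj (ip (smul c x) z + of_real ((norm d)\<^sup>2))"
      unfolding left[symmetric] by (rule ip_commute)
    then have "ip y (smul c x') = ip z (smul c x) + of_real ((norm d)\<^sup>2)"
      unfolding conj_add conj_of_real ip_commute[of z "smul c x", symmetric] .
    ultimately have "2 * of_real ((norm d)\<^sup>2) = (0 :: 'k)"
      unfolding left by (simp add: algebra_simps)
    then show "ip x' y = ip x z" by (simp add: d_def)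
  qed
qed

section \<open>Graphs of operators\<close>

lemma graph_eq_iff: "Map.graph S = Map.graph T \<longleftrightarrow> S = T"
proof
  assume "Map.graph S = Map.graph T"
  then have "S x = Some y \<longleftrightarrow> T x = Some y" for x y
    by (auto simp: graph_def set_eq_iff)
  then show "S = T" by (metis not_Some_eq ext)
qed simp

lemma in_graph_iff: "(x, y) \<in> Map.graph T \<longleftrightarrow> x \<in> dom T \<and> y = T \<cdot> x"
  by (auto simp: graph_def)

lemma graph_eq_image: "Map.graph T = (\<lambda>x. (x, T \<cdot> x)) ` dom T"
  by (force simp: graph_def)

lemma dom_eq_fst_graph: "dom T = fst ` Map.graph T"
  by (force simp: graph_def)

lemma graph_operator_closure:
  assumes "closable T"
  shows "Map.graph (operator_closure T) = closure (Map.graph T)"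
proof -
  have "operator_closure T x = Some y \<longleftrightarrow> (x, y) \<in> closure (Map.graph T)" for x y
  proof
    assume "operator_closure T x = Some y"
    then have dom: "x \<in> Domain (closure (Map.graph T))" and y: "y = (THE y. (x, y) \<in> closure (Map.graph T))"
      by (auto simp: operator_closure_def split: if_splits)
    from dom obtain y' where y': "(x, y') \<in> closure (Map.graph T)" by blast
    then have "y = y'"
      unfolding y using assms by (intro the_equality) (auto simp: closable_def single_valued_def)
    with y' show "(x, y) \<in> closure (Map.graph T)" by simp
  next
    assume xy: "(x, y) \<in> closure (Map.graph T)"
    then have "(THE y. (x, y) \<in> closure (Map.graph T)) = y"
      using assms by (intro the_equality) (auto simp: closable_def single_valued_def)
    then show "operator_closure T x = Some y"
      using xy by (auto simp: operator_closure_def)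
  qed
  then show ?thesis by (auto simp: graph_def)
qed

lemma graph_smul_closed:
  assumes "linear_operator smul T" "(x, x') \<in> Map.graph T"
  shows "(smul c x, smul c x') \<in> Map.graph T"
  using assms unfolding linear_operator_def subspace_def in_graph_iff by simp

lemma closure_smul_closed:
  assumes "\<And>c x x'. (x, x') \<in> S \<Longrightarrow> (smul c x, smul c x') \<in> S" and "(x, x') \<in> closure S"
  shows "(smul c x, smul c x') \<in> closure S"
proof -
  let ?h = "\<lambda>p. (smul c (fst p), smul c (snd p))"
  have "continuous_on (closure S) ?h"
    by (intro continuous_on_Pair bounded_linear.continuous_on[OF bounded_linear_smul] continuous_intros)
  moreover have "?h ` S \<subseteq> closure S"
    using assms(1) closure_subset[of S] by auto
  ultimately have "?h ` closure S \<subseteq> closure S"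
    by (intro image_closure_subset) auto
  from subsetD[OF this imageI[OF assms(2)]] show ?thesis by simp
qed

lemma subspace_graph:
  assumes "linear_operator smul T"
  shows "Real_Vector_Spaces.subspace (Map.graph T)"
proof -
  have T: "subspace (dom T)" "\<And>x y. x \<in> dom T \<Longrightarrow> y \<in> dom T \<Longrightarrow> T \<cdot> (x + y) = T \<cdot> x + T \<cdot> y"
    using assms by (auto simp: linear_operator_def)
  show ?thesis
  proof (rule Real_Vector_Spaces.subspaceI)
    have "T \<cdot> 0 = T \<cdot> 0 + T \<cdot> 0"
      using T(2)[of 0 0] subspace_0[OF T(1)] by simp
    then show "0 \<in> Map.graph T"
      unfolding graph_eq_image using subspace_0[OF T(1)] by (auto simp: zero_prod_def)
  next
    fix p q assume "p \<in> Map.graph T" "q \<in> Map.graph T"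
    then show "p + q \<in> Map.graph T"
      using T(2) subspace_add[OF T(1)] by (cases p; cases q) (simp add: in_graph_iff)
  next
    fix c :: real and p assume "p \<in> Map.graph T"
    then show "c *\<^sub>R p \<in> Map.graph T"
      using graph_smul_closed[OF assms, of "fst p" "snd p" "of_real c"]
      by (simp add: scale_of_real scaleR_prod_def)
  qed
qed

text \<open>Density makes the vector in the definite description unique, and invariance under
  scalars lets the real form replace \<open>ip\<close>.\<close>

lemma graph_adjoint_operator:
  assumes dense: "closure (dom T) = UNIV"
    and smul: "\<And>c x x'. (x, x') \<in> Map.graph T \<Longrightarrow> (smul c x, smul c x') \<in> Map.graph T"
  shows "Map.graph (adjoint_operator ip T) = real.adjoint_rel (Map.graph T)"
proof -
  have adj: "(y, z) \<in> real.adjoint_rel (Map.graph T) \<longleftrightarrow> (\<forall>x\<in>dom T. ip (T \<cdot> x) y = ip x z)" for y z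
  proof -
    have "(y, z) \<in> real.adjoint_rel (Map.graph T) \<longleftrightarrow> (\<forall>(x, x')\<in>Map.graph T. ip x' y = ip x z)"
      by (rule adjoint_rel_iff_ip) (rule smul)
    also have "\<dots> \<longleftrightarrow> (\<forall>x\<in>dom T. ip (T \<cdot> x) y = ip x z)"
      by (simp add: graph_eq_image)
    finally show ?thesis .
  qed
  have unique: "z = z'" if "(y, z) \<in> real.adjoint_rel (Map.graph T)" "(y, z') \<in> real.adjoint_rel (Map.graph T)" for y z z'
    using dense that by (intro real.adjoint_rel_unique) (simp_all add: dom_eq_fst_graph)
  have "adjoint_operator ip T y = Some z \<longleftrightarrow> (y, z) \<in> real.adjoint_rel (Map.graph T)" for y z
  proof
    assume "adjoint_operator ip T y = Some z"
    then obtain z' where z': "(y, z') \<in> real.adjoint_rel (Map.graph T)"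
      and z: "z = (THE z. (y, z) \<in> real.adjoint_rel (Map.graph T))"
      by (auto simp: adjoint_operator_def adj split: if_splits)
    have "z = z'" unfolding z using z' by (rule the_equality) (rule unique[OF _ z'])
    with z' show "(y, z) \<in> real.adjoint_rel (Map.graph T)" by simp
  next
    assume z: "(y, z) \<in> real.adjoint_rel (Map.graph T)"
    have "(THE z. (y, z) \<in> real.adjoint_rel (Map.graph T)) = z"
      using z by (rule the_equality) (rule unique[OF _ z])
    with z show "adjoint_operator ip T y = Some z"
      unfolding adjoint_operator_def adj by auto
  qed
  then show ?thesis by (auto simp: graph_def)
qed

text \<open>This moves the problem to real graphs. Taking the closure changes neither the adjoint
  nor whether the domain is dense.\<close>

lemma essentially_selfadjoint_iff:
  assumes T: "linear_operator smul T"
  shows "essentially_selfadjoint ip T \<longleftrightarrow>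
    closure (dom T) = UNIV \<and> real.adjoint_rel (Map.graph T) = closure (Map.graph T)"
proof -
  let ?G = "Map.graph T" and ?C = "operator_closure T"
  have dense_iff: "closure (dom ?C) = UNIV \<longleftrightarrow> closure (dom T) = UNIV" if "closable T"
  proof -
    have "dom T \<subseteq> dom ?C"
      unfolding dom_eq_fst_graph graph_operator_closure[OF that] by (intro image_mono closure_subset)
    then have "closure (dom T) \<subseteq> closure (dom ?C)" by (rule closure_mono)
    moreover have "dom ?C \<subseteq> closure (dom T)"
      unfolding dom_eq_fst_graph graph_operator_closure[OF that]
      by (intro image_closure_subset continuous_intros) (auto simp: closure_subset)
    then have "closure (dom ?C) \<subseteq> closure (dom T)" by (rule closure_minimal) simp
    ultimately show ?thesis by auto
  qed
  have adjoint_iff: "adjoint_operator ip ?C = ?C \<longleftrightarrow> real.adjoint_rel ?G = closure ?G"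
    if "closable T" "closure (dom ?C) = UNIV"
  proof -
    have "Map.graph (adjoint_operator ip ?C) = real.adjoint_rel (closure ?G)"
      unfolding graph_operator_closure[OF that(1), symmetric]
      using closure_smul_closed[OF graph_smul_closed[OF T]]
      by (intro graph_adjoint_operator[OF that(2)]) (simp only: graph_operator_closure[OF that(1)])
    then show ?thesis
      unfolding graph_eq_iff[symmetric] graph_operator_closure[OF that(1)] real.adjoint_rel_closure by simp
  qed
  \<comment> \<open>The closure of the graph is here the adjoint of a densely defined relation,
    hence single-valued.\<close>
  have closable: "closable T" if dense: "closure (dom T) = UNIV" and adj: "real.adjoint_rel ?G = closure ?G"
    using real.adjoint_rel_unique[of ?G] dense
    unfolding closable_def single_valued_def adj[symmetric] dom_eq_fst_graph by blast
  show ?thesis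
    unfolding essentially_selfadjoint_def selfadjoint_def densely_defined_def
    using dense_iff adjoint_iff closable by blast
qed

lemma symmetric_polar_form:
  assumes "symmetric ip T" "x \<in> dom T" "y \<in> dom T"
  shows "polar_form (T \<cdot> x) y = polar_form x (T \<cdot> y)"
proof -
  have "of_real (2 * polar_form (T \<cdot> x) y) = (of_real (2 * polar_form x (T \<cdot> y)) :: 'k)"
    unfolding of_real_polar_form using assms by (simp add: symmetric_def)
  then show ?thesis by (simp only: of_real_eq_iff)
qed

end

section \<open>Stability of essential selfadjointness under the perturbation\<close>

theorem theorem3p4:
  fixes smul :: "'k::real_or_complex \<Rightarrow> 'h::banach \<Rightarrow> 'h"
    and ip :: "'h \<Rightarrow> 'h \<Rightarrow> 'k"
    and A B :: "'h \<rightharpoonup> 'h"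
  assumes "hilbert_space smul ip"
    and "linear_operator smul A" and "linear_operator smul B"
    and "symmetric ip A" and "symmetric ip B"
    and "essentially_selfadjoint ip A"
    and "relatively_bounded A B"
    and "\<exists>b>0. \<forall>x\<in>dom A. (norm (B \<cdot> x))\<^sup>2 \<le>
           (norm (A \<cdot> x))\<^sup>2 + (norm ((A \<oplus> B) \<cdot> x))\<^sup>2 + b\<^sup>2 * (norm x)\<^sup>2"
  shows "essentially_selfadjoint ip (A \<oplus> B)"
proof -
  interpret hilbert_space smul ip by fact
  let ?T = "A \<oplus> B"
  obtain \<alpha> \<beta> where dom_sub: "dom A \<subseteq> dom B" and \<alpha>: "\<alpha> \<ge> 0" and \<beta>: "\<beta> \<ge> 0"
    and bounded: "\<And>x. x \<in> dom A \<Longrightarrow> (norm (B \<cdot> x))\<^sup>2 \<le> \<alpha> * (norm (A \<cdot> x))\<^sup>2 + \<beta> * (norm x)\<^sup>2"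
    using \<open>relatively_bounded A B\<close> unfolding relatively_bounded_def by blast
  obtain b where b: "b > 0" and B_le: "\<And>x. x \<in> dom A \<Longrightarrow>
      (norm (B \<cdot> x))\<^sup>2 \<le> (norm (A \<cdot> x))\<^sup>2 + (norm (?T \<cdot> x))\<^sup>2 + b\<^sup>2 * (norm x)\<^sup>2"
    using assms(8) by blast
  have "dom ?T = dom A \<inter> dom B"
    by (auto simp: operator_plus_def split: if_splits)
  then have dom_T: "dom ?T = dom A"
    using dom_sub by (simp only: inf.absorb1)
  have T_eq: "?T \<cdot> x = A \<cdot> x + B \<cdot> x" if "x \<in> dom A" for x
    using that subsetD[OF dom_sub that] by (simp add: operator_plus_def)
  have lin_T: "linear_operator smul ?T"
    using \<open>linear_operator smul A\<close> \<open>linear_operator smul B\<close> subsetD[OF dom_sub]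
    unfolding linear_operator_def dom_T
    by (simp add: T_eq subspace_add subspace_scale scale_right_distrib)
  have dense: "closure (dom A) = UNIV"
    and adj_A: "real.adjoint_rel (Map.graph A) = closure (Map.graph A)"
    using \<open>essentially_selfadjoint ip A\<close> \<open>linear_operator smul A\<close>
    by (simp_all add: essentially_selfadjoint_iff)
  have sym_A: "polar_form (A \<cdot> x) y = polar_form x (A \<cdot> y)" if "x \<in> dom A" "y \<in> dom A" for x y
    using symmetric_polar_form[OF \<open>symmetric ip A\<close>] that .
  have sym_T: "polar_form (?T \<cdot> x) y = polar_form x (?T \<cdot> y)" if "x \<in> dom A" "y \<in> dom A" for x y
    using sym_A[OF that] symmetric_polar_form[OF \<open>symmetric ip B\<close>] that subsetD[OF dom_sub]
    by (simp add: T_eq real.inn_add real.inn_add_right)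
  have lower: "- (b\<^sup>2 / 2) * (norm x)\<^sup>2 \<le> polar_form (A \<cdot> x) (?T \<cdot> x)" if "x \<in> dom A" for x
    using B_le[OF that] real.norm_diff_squared[of "A \<cdot> x" "?T \<cdot> x"] T_eq[OF that]
    by simp
  \<comment> \<open>The parallelogram law gives \<open>|Ax + Bx|^2 \<le> 2|Ax|^2 + 2|Bx|^2\<close>;
    inserting the relative bound of \<open>B\<close> yields the constants.\<close>
  have bound: "(norm (?T \<cdot> x))\<^sup>2 \<le> (2 + 2 * \<alpha>) * (norm (A \<cdot> x))\<^sup>2 + (2 * \<beta>) * (norm x)\<^sup>2"
    if "x \<in> dom A" for x
    using bounded[OF that] real.parallelogram[of "A \<cdot> x" "B \<cdot> x"] zero_le_power2[of "norm (A \<cdot> x - B \<cdot> x)"]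
    unfolding T_eq[OF that] by (simp only: distrib_right mult.assoc)
  have "real.adjoint_rel (Map.graph ?T) = closure (Map.graph ?T)"
  proof (rule real.adjoint_rel_eq_closure)
    show "Real_Vector_Spaces.subspace (Map.graph ?T)"
      using lin_T by (rule subspace_graph)
    show "Map.graph ?T \<subseteq> real.adjoint_rel (Map.graph ?T)"
      unfolding graph_eq_image dom_T by (auto intro!: real.adjoint_relI sym_T)
    show "b \<noteq> 0" using b by simp
    show "u = 0 \<and> v = 0"
      if "(u, - b *\<^sub>R v) \<in> real.adjoint_rel (Map.graph ?T)"
        and "(v, b *\<^sub>R u) \<in> real.adjoint_rel (Map.graph ?T)" for u v
    proof (rule real.deficiency_trivial[where A = "\<lambda>x. A \<cdot> x" and T = "\<lambda>x. ?T \<cdot> x" and D = "dom A"])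
      show "Real_Vector_Spaces.subspace ((\<lambda>x. (x, A \<cdot> x)) ` dom A)"
        using subspace_graph[OF \<open>linear_operator smul A\<close>] by (simp add: graph_eq_image)
      show "real.adjoint_rel ((\<lambda>x. (x, A \<cdot> x)) ` dom A) = closure ((\<lambda>x. (x, A \<cdot> x)) ` dom A)"
        using adj_A by (simp add: graph_eq_image)
      show "(u, - b *\<^sub>R v) \<in> real.adjoint_rel ((\<lambda>x. (x, ?T \<cdot> x)) ` dom A)"
        "(v, b *\<^sub>R u) \<in> real.adjoint_rel ((\<lambda>x. (x, ?T \<cdot> x)) ` dom A)"
        using that unfolding graph_eq_image dom_T .
      show "0 \<le> 2 + 2 * \<alpha>" "0 \<le> 2 * \<beta>" using \<alpha> \<beta> by simp_all
    qed (fact dense sym_A sym_T b lower bound)+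
  qed
  then show ?thesis
    using dense lin_T by (simp add: essentially_selfadjoint_iff dom_T)
qed

end
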